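(* The family of maps $\delta_X:\mathsf{H}\mathsf{Q}X\to\mathsf{Q}\mathsf{H}X$ defined by \[ \delta_X(f,d)=\{(g,d)\in\mathsf{H}X\mid \forall t\in[0,d].\ g(t)\in f(t)\} \] is a distributive law $\delta:\mathsf{H}\mathsf{Q}\to\mathsf{Q}\mathsf{H}$ of the non-empty powerset monad $\mathsf{Q}$ over the hybrid monad $\mathsf{H}$; that is, $\delta$ is a natural transformation satisfying $\delta\circ\mathsf{H}\eta^{\mathsf{Q}}=\eta^{\mathsf{Q}}_{\mathsf{H}}$, $\delta\circ\eta^{\mathsf{H}}_{\mathsf{Q}}=\mathsf{Q}\eta^{\mathsf{H}}$, $\delta\circ\mathsf{H}\mu^{\mathsf{Q}}=\mu^{\mathsf{Q}}_{\mathsf{H}}\circ\mathsf{Q}\delta\circ\delta_{\mathsf{Q}}$ and $\delta\circ\mu^{\mathsf{H}}_{\mathsf{Q}}=\mathsf{Q}\mu^{\mathsf{H}}\circ\delta_{\mathsf{H}}\circ\mathsf{H}\delta$.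
   Context: The hybrid monad $\mathsf{H}:\mathbf{Set}\to\mathbf{Set}$ has $\mathsf{H}X=\coprod_{d\in[0,\infty)}\hom([0,d],X)$, i.e. pairs $(f,d)$ with $d\ge0$ and $f:[0,d]\to X$ (an "evolution" of duration $d$), acting on maps by postcomposition. Its unit is $\eta^{\mathsf{H}}_X(x)=(\underline{x},0)$ with $\underline{x}$ the constant function, and its multiplication is $\mu^{\mathsf{H}}_X(f,d)=(\theta_X\circ f,d)\mathbin{+\!\!+}f(d)$, where $\theta_X:\mathsf{H}X\to X$, $\theta_X(g,e)=g(0)$, and $\mathbin{+\!\!+}$ concatenates evolutions: $(f,d)\mathbin{+\!\!+}(g,e)=(h,d+e)$ with $h(t)=f(t)$ for $t<d$ and $h(t)=g(t-d)$ for $d\le t\le d+e$. $\mathsf{Q}:\mathbf{Set}\to\mathbf{Set}$ is the non-empty powerset monad: $\mathsf{Q}X$ is the set of non-empty subsets of $X$, maps act by direct image, $\eta^{\mathsf{Q}}_X(x)=\{x\}$ and $\mu^{\mathsf{Q}}$ is union. *)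

theory Defs
  imports Complex_Main "HOL-Library.FuncSet"
begin

text \<open>
  Objects of the category of sets are rendered as arbitrary (possibly empty) sets
  \<open>X :: 'a set\<close>, and maps \<open>X \<rightarrow> Y\<close> as functions constrained on \<open>X\<close> only.
  Functions with domain \<open>[0,d]\<close> are rendered as extensional functions (equal to
  \<open>undefined\<close> off \<open>{0..d}\<close>), so that equality of evolutions is plain equality.
\<close>

type_synonym 'a evol = "(real \<Rightarrow> 'a) \<times> real"

definition H_obj :: "'a set \<Rightarrow> 'a evol set" where
  "H_obj X = {(f, d). 0 \<le> d \<and> f \<in> {0..d} \<rightarrow>\<^sub>E X}"

definition H_map :: "('a \<Rightarrow> 'b) \<Rightarrow> 'a evol \<Rightarrow> 'b evol" where
  "H_map h = (\<lambda>(f, d). (restrict (h \<circ> f) {0..d}, d))"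

definition H_unit :: "'a \<Rightarrow> 'a evol" where
  "H_unit x = (restrict (\<lambda>_. x) {0..0}, 0)"

definition H_theta :: "'a evol \<Rightarrow> 'a" where
  "H_theta = (\<lambda>(g, e). g 0)"

definition H_conc :: "'a evol \<Rightarrow> 'a evol \<Rightarrow> 'a evol" where
  "H_conc = (\<lambda>(f, d) (g, e).
     (restrict (\<lambda>t. if t < d then f t else g (t - d)) {0..d + e}, d + e))"

definition H_mult :: "'a evol evol \<Rightarrow> 'a evol" where
  "H_mult = (\<lambda>(f, d). H_conc (H_map H_theta (f, d)) (f d))"

definition Q_obj :: "'a set \<Rightarrow> 'a set set" where
  "Q_obj X = {A. A \<subseteq> X \<and> A \<noteq> {}}"

definition Q_map :: "('a \<Rightarrow> 'b) \<Rightarrow> 'a set \<Rightarrow> 'b set" where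
  "Q_map h A = h ` A"

definition Q_unit :: "'a \<Rightarrow> 'a set" where
  "Q_unit x = {x}"

definition Q_mult :: "'a set set \<Rightarrow> 'a set" where
  "Q_mult \<A> = \<Union>\<A>"

definition delta :: "'a set \<Rightarrow> 'a set evol \<Rightarrow> 'a evol set" where
  "delta X = (\<lambda>(f, d). {(g, e). (g, e) \<in> H_obj X \<and> e = d \<and> (\<forall>t\<in>{0..d}. g t \<in> f t)})"

end

theory Submission
  imports Defs
begin

text \<open>
  On evolutions of non-empty sets, \<open>\<delta>\<close> is the dependent product
  \<open>(f, d) \<mapsto> (\<Pi> t \<in> [0,d]. f t) \<times> {d}\<close>. The inclusions of each axiom that are not immediate
  say that a selection of the composite family lifts to selections of the inner ones, which are
  obtained by choice. In these lifts, non-emptiness matters only for \<open>\<mu>\<^sup>H\<close>: a lift there has to select from the parts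
  of the inner evolutions that concatenation discards.
\<close>

lemma H_obj_iff [simp]: "(f, d) \<in> H_obj X \<longleftrightarrow> 0 \<le> d \<and> f \<in> {0..d} \<rightarrow>\<^sub>E X"
  by (simp add: H_obj_def)

lemma H_map_Pair [simp]: "H_map h (f, d) = (restrict (h \<circ> f) {0..d}, d)"
  by (simp add: H_map_def)

lemma H_map_in_H_obj: "p \<in> H_obj X \<Longrightarrow> h \<in> X \<rightarrow> Y \<Longrightarrow> H_map h p \<in> H_obj Y"
  by (cases p) auto

text \<open>Each \<open>f t\<close> is a subset of \<open>X\<close>, so selecting from
  \<open>f\<close> already forces values in \<open>X\<close>. What \<open>H_obj X\<close> still
  demands of \<open>g\<close> is extensionality, which \<open>PiE\<close> includes.\<close>

lemma delta_eq_PiE: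
  assumes "(f, d) \<in> H_obj (Q_obj X)"
  shows "delta X (f, d) = PiE {0..d} f \<times> {d}"
proof -
  have "f t \<subseteq> X" if "t \<in> {0..d}" for t
    using assms that by (auto simp: Q_obj_def)
  then have "g \<in> {0..d} \<rightarrow>\<^sub>E X \<and> (\<forall>t\<in>{0..d}. g t \<in> f t) \<longleftrightarrow> g \<in> PiE {0..d} f" for g
    unfolding PiE_iff by blast
  with assms show ?thesis
    by (auto simp: delta_def)
qed

text \<open>Non-emptiness is the axiom of choice: a product of non-empty sets is non-empty.\<close>

lemma delta_in_Q_obj:
  assumes "p \<in> H_obj (Q_obj X)"
  shows "delta X p \<in> Q_obj (H_obj X)"
proof (cases p)
  case (Pair f d)
  have "f t \<noteq> {}" if "t \<in> {0..d}" for t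
    using assms that by (auto simp: Q_obj_def Pair)
  then have "delta X p \<noteq> {}"
    using assms by (simp add: Pair delta_eq_PiE PiE_eq_empty_iff del: H_obj_iff)
  moreover have "delta X p \<subseteq> H_obj X"
    by (auto simp: delta_def Pair)
  ultimately show ?thesis
    by (simp add: Q_obj_def)
qed

lemma PiE_choice:
  assumes "\<And>i. i \<in> I \<Longrightarrow> \<exists>x\<in>A i. P i x"
  shows "\<exists>f\<in>PiE I A. \<forall>i\<in>I. P i (f i)"
proof -
  obtain f where "\<And>i. i \<in> I \<Longrightarrow> f i \<in> A i \<and> P i (f i)"
    using assms by metis
  then show ?thesis
    by (intro bexI[of _ "restrict f I"]) auto
qed

text \<open>The core of naturality: a selection of images lifts by choosing a preimage at every
  index.\<close>

lemma PiE_image_eq: "PiE I (\<lambda>i. h ` f i) = (\<lambda>g. restrict (h \<circ> g) I) ` PiE I f"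
proof (intro set_eqI iffI)
  fix g assume g: "g \<in> PiE I (\<lambda>i. h ` f i)"
  then have "\<exists>x\<in>f i. h x = g i" if "i \<in> I" for i
    using that by (force simp: PiE_iff)
  then obtain k where "k \<in> PiE I f" "\<And>i. i \<in> I \<Longrightarrow> h (k i) = g i"
    using PiE_choice[of I f "\<lambda>i x. h x = g i"] by blast
  \<comment> \<open>Off \<open>I\<close> both sides are \<open>undefined\<close>, so agreement on
    \<open>I\<close> suffices.\<close>
  moreover from this have "g = restrict (h \<circ> k) I"
    using g by (auto simp: fun_eq_iff PiE_iff extensional_def)
  ultimately show "g \<in> (\<lambda>g. restrict (h \<circ> g) I) ` PiE I f"
    by blast
qed auto

text \<open>Distributivity of products over unions, the core of the axiom for \<open>Q_mult\<close>:
  choose at every index a member of \<open>f i\<close> that contains \<open>g i\<close>.\<close>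

lemma PiE_Union_eq: "PiE I (\<lambda>i. \<Union> (f i)) = (\<Union>F\<in>PiE I f. PiE I F)"
proof (intro set_eqI iffI)
  fix g assume g: "g \<in> PiE I (\<lambda>i. \<Union> (f i))"
  then have "\<exists>A\<in>f i. g i \<in> A" if "i \<in> I" for i
    using that by (force simp: PiE_iff)
  then obtain F where "F \<in> PiE I f" "\<And>i. i \<in> I \<Longrightarrow> g i \<in> F i"
    using PiE_choice[of I f "\<lambda>i A. g i \<in> A"] by blast
  moreover from this have "g \<in> PiE I F"
    using g by (simp add: PiE_iff)
  ultimately show "g \<in> (\<Union>F\<in>PiE I f. PiE I F)"
    by blast
next
  fix g assume "g \<in> (\<Union>F\<in>PiE I f. PiE I F)"
  then obtain F where "F \<in> PiE I f" "g \<in> PiE I F"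
    by (rule UN_E)
  then show "g \<in> PiE I (\<lambda>i. \<Union> (f i))"
    unfolding PiE_iff by blast
qed

lemma PiE_restrict_family: "PiE I (restrict A I) = PiE I A"
  by (rule PiE_cong) simp

text \<open>Serves every axiom that applies \<open>delta\<close> after some \<open>H_map h\<close>,
  with \<open>h\<close> being \<open>Q_map _\<close>, \<open>Q_unit\<close>, \<open>Q_mult\<close>
  or \<open>delta X\<close>. The typing of \<open>h\<close> makes the product form
  available.\<close>

lemma delta_H_map:
  assumes "(f, d) \<in> H_obj Z" "h \<in> Z \<rightarrow> Q_obj X"
  shows "delta X (H_map h (f, d)) = PiE {0..d} (\<lambda>t. h (f t)) \<times> {d}"
proof -
  have "H_map h (f, d) \<in> H_obj (Q_obj X)"
    using assms by (rule H_map_in_H_obj)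
  then show ?thesis
    by (simp add: delta_eq_PiE PiE_restrict_family comp_def del: H_obj_iff)
qed

lemma delta_natural:
  assumes h: "h \<in> X \<rightarrow> Y" and p: "p \<in> H_obj (Q_obj X)"
  shows "delta Y (H_map (Q_map h) p) = Q_map (H_map h) (delta X p)"
proof (cases p)
  case (Pair f d)
  have "Q_map h \<in> Q_obj X \<rightarrow> Q_obj Y"
    using h by (fastforce simp: Q_map_def Q_obj_def)
  from delta_H_map[OF p[unfolded Pair] this]
  have "delta Y (H_map (Q_map h) p) = PiE {0..d} (\<lambda>t. h ` f t) \<times> {d}"
    by (simp add: Pair Q_map_def del: H_map_Pair)
  also have "\<dots> = Q_map (H_map h) (PiE {0..d} f \<times> {d})"
    unfolding PiE_image_eq by (force simp: Q_map_def)
  finally show ?thesis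
    using p by (simp add: Pair delta_eq_PiE del: H_obj_iff)
qed

lemma delta_H_map_Q_unit:
  assumes p: "p \<in> H_obj X"
  shows "delta X (H_map Q_unit p) = Q_unit p"
proof (cases p)
  case (Pair f d)
  have "Q_unit \<in> X \<rightarrow> Q_obj X"
    by (auto simp: Q_unit_def Q_obj_def)
  from delta_H_map[OF p[unfolded Pair] this]
  have "delta X (H_map Q_unit p) = PiE {0..d} (\<lambda>t. {f t}) \<times> {d}"
    by (simp add: Pair Q_unit_def del: H_map_Pair)
  also have "PiE {0..d} (\<lambda>t. {f t}) = {f}"
    using p by (intro PiE_singleton) (simp add: Pair PiE_iff)
  finally show ?thesis
    by (simp add: Pair Q_unit_def[of "(f, d)"] del: H_map_Pair)
qed

text \<open>At duration 0 the interval is \<open>{0}\<close>, and an extensional function on it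
  amounts to its value at 0.\<close>

lemma delta_H_unit:
  assumes "A \<in> Q_obj X"
  shows "delta X (H_unit A) = Q_map H_unit A"
proof -
  have "delta X (H_unit A) = PiE {0} (\<lambda>_. A) \<times> {0}"
    using assms delta_eq_PiE[of "\<lambda>_\<in>{0}. A" 0 X]
    by (simp add: H_unit_def PiE_restrict_family)
  also have "\<dots> = Q_map H_unit A"
    unfolding PiE_over_singleton_iff by (auto simp: Q_map_def H_unit_def)
  finally show ?thesis .
qed

lemma delta_H_map_Q_mult:
  assumes p: "p \<in> H_obj (Q_obj (Q_obj X))"
  shows "delta X (H_map Q_mult p) = Q_mult (Q_map (delta X) (delta (Q_obj X) p))"
proof (cases p)
  case (Pair f d)
  have "Q_mult \<in> Q_obj (Q_obj X) \<rightarrow> Q_obj X"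
    by (fastforce simp: Q_mult_def Q_obj_def)
  from delta_H_map[OF p[unfolded Pair] this]
  have "delta X (H_map Q_mult p) = PiE {0..d} (\<lambda>t. \<Union> (f t)) \<times> {d}"
    by (simp add: Pair Q_mult_def del: H_map_Pair)
  also have "\<dots> = (\<Union>F\<in>PiE {0..d} f. PiE {0..d} F \<times> {d})"
    unfolding PiE_Union_eq by blast
  also have "\<dots> = (\<Union>q\<in>PiE {0..d} f \<times> {d}. delta X q)"
  proof -
    \<comment> \<open>The members of \<open>f t\<close> lie in \<open>Q_obj X\<close>, so each
      selection \<open>F\<close> is again an evolution of non-empty subsets of
      \<open>X\<close>.\<close>
    have "(F, d) \<in> H_obj (Q_obj X)" if "F \<in> PiE {0..d} f" for F
      using that p by (fastforce simp: Pair PiE_iff Q_obj_def)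
    then have "delta X (F, d) = PiE {0..d} F \<times> {d}" if "F \<in> PiE {0..d} f" for F
      using that by (intro delta_eq_PiE)
    moreover have "(\<Union>q\<in>P \<times> {d}. delta X q) = (\<Union>F\<in>P. delta X (F, d))" for P
      by auto
    ultimately show ?thesis
      by simp
  qed
  finally show ?thesis
    using p by (simp add: Pair delta_eq_PiE Q_mult_def Q_map_def del: H_obj_iff)
qed

text \<open>The \<open>restrict\<close> inside \<open>H_map\<close> disappears because concatenation
  reads its first argument only at times t with 0 \<le> t < d.\<close>

lemma H_mult_Pair:
  assumes "0 \<le> d"
  shows "H_mult (F, d) =
    (restrict (\<lambda>t. if t < d then fst (F t) 0 else fst (F d) (t - d)) {0..d + snd (F d)},
     d + snd (F d))"
  by (auto simp: H_mult_def H_conc_def H_theta_def fun_eq_iff split: prod.split)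

lemma H_mult_in_H_obj:
  assumes "p \<in> H_obj (H_obj X)"
  shows "H_mult p \<in> H_obj X"
proof (cases p)
  case (Pair F d)
  have "F \<in> {0..d} \<rightarrow>\<^sub>E H_obj X"
    using assms by (simp add: Pair)
  then have "F t \<in> H_obj X" if "t \<in> {0..d}" for t
    using that by (rule PiE_mem)
  then have Ft: "0 \<le> snd (F t)" "fst (F t) \<in> {0..snd (F t)} \<rightarrow>\<^sub>E X" if "t \<in> {0..d}" for t
    using that by (simp_all add: H_obj_def case_prod_beta)
  have "fst (F t) s \<in> X" if "t \<in> {0..d}" "s \<in> {0..snd (F t)}" for t s
    using PiE_mem[OF Ft(2)] that by blast
  moreover have "0 \<le> d"
    using assms by (simp add: Pair)
  ultimately show ?thesis
    using Ft(1) by (simp add: Pair H_mult_Pair)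
qed

lemma delta_H_mult:
  assumes p: "p \<in> H_obj (H_obj (Q_obj X))"
  shows "delta X (H_mult p) = Q_map H_mult (delta (H_obj X) (H_map (delta X) p))"
proof (cases p)
  case (Pair F d)
  define f e where "f t = fst (F t)" and "e t = snd (F t)" for t
  \<comment> \<open>The set-valued evolution underlying \<open>H_mult p\<close>. At the junction t =
    d it takes the value \<open>f d 0\<close>.\<close>
  define m where "m t = (if t < d then f t 0 else f d (t - d))" for t
  have d: "0 \<le> d"
    using p by (simp add: Pair)
  have F_eq: "F t = (f t, e t)" for t
    by (simp add: f_def e_def)
  have "F \<in> {0..d} \<rightarrow>\<^sub>E H_obj (Q_obj X)"
    using p by (simp add: Pair)
  then have F: "(f t, e t) \<in> H_obj (Q_obj X)" if "t \<in> {0..d}" for t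
    unfolding F_eq[symmetric] using that by (rule PiE_mem)
  have e: "0 \<le> e t" if "t \<in> {0..d}" for t
    using F[OF that] by simp
  have f_ne: "f t s \<noteq> {}" if "t \<in> {0..d}" "s \<in> {0..e t}" for t s
    using F[OF that(1)] that(2) by (auto simp: Q_obj_def)
  have m_eq: "m = (\<lambda>t. if t < d then fst (F t) 0 else fst (F d) (t - d))"
    by (simp add: m_def f_def fun_eq_iff)
  have lhs: "delta X (H_mult p) = PiE {0..d + e d} m \<times> {d + e d}"
    using H_mult_in_H_obj[OF p] d
    by (simp add: Pair H_mult_Pair delta_eq_PiE PiE_restrict_family m_eq e_def del: H_obj_iff)
  have "delta X \<in> H_obj (Q_obj X) \<rightarrow> Q_obj (H_obj X)"
    using delta_in_Q_obj by blast
  from delta_H_map[OF p[unfolded Pair] this]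
  have "delta (H_obj X) (H_map (delta X) p) = PiE {0..d} (\<lambda>t. delta X (F t)) \<times> {d}"
    by (simp add: Pair del: H_map_Pair)
  also have "PiE {0..d} (\<lambda>t. delta X (F t)) = PiE {0..d} (\<lambda>t. PiE {0..e t} (f t) \<times> {e t})"
    using F by (intro PiE_cong) (simp add: F_eq delta_eq_PiE del: H_obj_iff)
  finally have rhs: "Q_map H_mult (delta (H_obj X) (H_map (delta X) p)) =
      (\<lambda>G. H_mult (G, d)) ` PiE {0..d} (\<lambda>t. PiE {0..e t} (f t) \<times> {e t})"
    by (force simp: Q_map_def)
  \<comment> \<open>Concatenating selections of the inner evolutions selects from \<open>m\<close>
    at every time.\<close>
  have "H_mult (G, d) \<in> PiE {0..d + e d} m \<times> {d + e d}"
    if G: "G \<in> PiE {0..d} (\<lambda>t. PiE {0..e t} (f t) \<times> {e t})" for G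
  proof -
    have "\<And>s. s \<in> {0..e t} \<Longrightarrow> fst (G t) s \<in> f t s" "snd (G t) = e t" if "t \<in> {0..d}" for t
      using PiE_mem[OF G that] by auto
    then show ?thesis
      using d e by (simp add: H_mult_Pair m_def)
  qed
  then have sub: "(\<lambda>G. H_mult (G, d)) ` PiE {0..d} (\<lambda>t. PiE {0..e t} (f t) \<times> {e t})
      \<subseteq> PiE {0..d + e d} m \<times> {d + e d}"
    by (rule image_subsetI)
  have "(g, d + e d) \<in> (\<lambda>G. H_mult (G, d)) ` PiE {0..d} (\<lambda>t. PiE {0..e t} (f t) \<times> {e t})"
    if g: "g \<in> PiE {0..d + e d} m" for g
  proof -
    \<comment> \<open>Only \<open>c t 0\<close> for \<open>t < d\<close> and all of \<open>c d\<close> enter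
      \<open>H_mult (G, d)\<close>, so the other values are arbitrary.\<close>
    define c where "c t s = (if t = d then g (d + s) else if s = 0 then g t else SOME x. x \<in> f t s)"
      for t s
    define G where "G = (\<lambda>t\<in>{0..d}. (restrict (c t) {0..e t}, e t))"
    \<comment> \<open>In the first case s \<ge> 0 gives \<open>m (d + s) = f d s\<close>; in the
      second \<open>m t = f t 0\<close>, and \<open>e d\<close> being non-negative puts t in the
      domain of \<open>g\<close>. In the third, \<open>SOME\<close> is justified by
      \<open>f t s\<close> being non-empty.\<close>
    have "c t s \<in> f t s" if t: "t \<in> {0..d}" and s: "s \<in> {0..e t}" for t s
    proof -
      consider "t = d" | "t < d" "s = 0" | "t < d" "s \<noteq> 0"
        using t by fastforce
      then show ?thesis
      proof cases
        case 1
        then show ?thesis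
          using PiE_mem[OF g, of "d + s"] s d by (simp add: c_def m_def)
      next
        case 2
        then show ?thesis
          using PiE_mem[OF g, of t] t e[of d] by (simp add: c_def m_def)
      next
        case 3
        then show ?thesis
          using f_ne[OF t s] by (simp add: c_def some_in_eq)
      qed
    qed
    then have "G \<in> PiE {0..d} (\<lambda>t. PiE {0..e t} (f t) \<times> {e t})"
      by (simp add: G_def)
    \<comment> \<open>From time d on, the second piece returns \<open>c d (t - d) = g t\<close>;
      before d, \<open>c t 0 = g t\<close>. Outside the interval both functions are
      \<open>undefined\<close>.\<close>
    moreover have "(g, d + e d) = H_mult (G, d)"
      using g d e by (auto simp: H_mult_Pair G_def c_def fun_eq_iff PiE_iff extensional_def)
    ultimately show ?thesis
      by blast
  qed
  then have "PiE {0..d + e d} m \<times> {d + e d}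
      \<subseteq> (\<lambda>G. H_mult (G, d)) ` PiE {0..d} (\<lambda>t. PiE {0..e t} (f t) \<times> {e t})"
    by (simp add: subset_iff)
  with sub show ?thesis
    unfolding lhs rhs by (intro equalityI)
qed

theorem theorem6p5:
  fixes X :: "'a set" and Y :: "'b set"
  shows "delta X \<in> H_obj (Q_obj X) \<rightarrow> Q_obj (H_obj X)
    \<and> (\<forall>h \<in> X \<rightarrow> Y. \<forall>p \<in> H_obj (Q_obj X).
          (delta Y \<circ> H_map (Q_map h)) p = (Q_map (H_map h) \<circ> delta X) p)
    \<and> (\<forall>p \<in> H_obj X. (delta X \<circ> H_map Q_unit) p = Q_unit p)
    \<and> (\<forall>A \<in> Q_obj X. (delta X \<circ> H_unit) A = Q_map H_unit A)
    \<and> (\<forall>p \<in> H_obj (Q_obj (Q_obj X)).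
          (delta X \<circ> H_map Q_mult) p = (Q_mult \<circ> Q_map (delta X) \<circ> delta (Q_obj X)) p)
    \<and> (\<forall>p \<in> H_obj (H_obj (Q_obj X)).
          (delta X \<circ> H_mult) p = (Q_map H_mult \<circ> delta (H_obj X) \<circ> H_map (delta X)) p)"
  by (simp add: delta_in_Q_obj delta_natural delta_H_map_Q_unit delta_H_unit delta_H_map_Q_mult
      delta_H_mult)

end
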